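(* Let $b,c>0$, $\nu>-\tfrac12$, and $t\in\mathbb{C}\setminus(-\infty,0]$. Then $$\int_0^\infty (\Delta(a,b,c))^{2\nu-1}\,a^{1-\nu}J_\nu(at)\,da=2^{1-\nu}\sqrt{\pi}\;\Gamma\left(\nu+\tfrac12\right)\left(\frac{bc}{t}\right)^{\nu}J_\nu(bt)\,J_\nu(ct),$$ where $\Delta:[0,\infty)^3\to[0,\infty)$ (Heron's formula), defined by $\Delta(a,b,c):=\sqrt{s(s-a)(s-b)(s-c)}$ with $s=(a+b+c)/2$, is the area of a triangle with sides of length $a$, $b$, and $c$.
   Context: $J_\nu:\mathbb{C}\setminus(-\infty,0]\to\mathbb{C}$ is the Bessel function of the first kind of order $\nu$, and $\Gamma$ is Euler's gamma function.
   Formalization: Where no triangle with sides a, b, c exists, Heron's radicand is negative and Δ is undefined as written; there Δ(a,b,c) is taken to be 0 and Δ^(2ν−1) is read as 0 for every ν > −1/2 (also ν ≤ 1/2), so the integral runs effectively over |b−c| ≤ a ≤ b+c. *)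

theory Defs
  imports "HOL-Analysis.Analysis"
begin

text \<open>
  Bessel function of the first kind by its power series,
  \<open>J\<^sub>\<nu>(z) = (z/2)\<^sup>\<nu> \<Sum>\<^sub>m (-1)\<^sup>m (z/2)\<^bsup>2m\<^esup> / (m! \<Gamma>(\<nu>+m+1))\<close>, on the plane cut along
  \<open>(-\<infinity>, 0]\<close>.  The power \<open>(z/2)\<^sup>\<nu>\<close> is the principal branch; \<^const>\<open>rGamma\<close> is the
  entire function \<open>1/\<Gamma>\<close>, so no order is exceptional.
\<close>

definition bessel_J :: "complex \<Rightarrow> complex \<Rightarrow> complex" where
  "bessel_J \<nu> z =
     (z / 2) powr \<nu> *
     (\<Sum>m. (- 1) ^ m * rGamma (\<nu> + of_nat m + 1) / fact m * (z / 2) ^ (2 * m))"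

text \<open>
  Area of the triangle with side lengths \<open>a, b, c \<ge> 0\<close>.  If no such triangle exists, the
  radicand in Heron's formula can be negative, and the area is set to \<open>0\<close>.  Since
  \<open>0 powr x = 0\<close> for every real \<open>x\<close> (also for \<open>x \<le> 0\<close>), every real power of
  the area then vanishes too.
\<close>

definition heron_area :: "real \<Rightarrow> real \<Rightarrow> real \<Rightarrow> real" where
  "heron_area a b c =
     (if a \<le> b + c \<and> b \<le> a + c \<and> c \<le> a + b
      then let s = (a + b + c) / 2 in sqrt (s * (s - a) * (s - b) * (s - c))
      else 0)"

end

theory Submission imports Defs begin

text \<open>
  Put \<open>a\<^sup>2 = b\<^sup>2 + c\<^sup>2 + 2bcv\<close> with \<open>-1 \<le> v \<le> 1\<close>; then \<open>\<Delta>(a,b,c)\<^sup>2 = b\<^sup>2c\<^sup>2(1 - v\<^sup>2)/4\<close>, and up to constants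
  the integral becomes that of \<open>(1 - v\<^sup>2) powr (\<nu> - 1/2)\<close> against a power series in \<open>a\<^sup>2\<close>.
  Integrating termwise, the moments of \<open>(b\<^sup>2 + c\<^sup>2 + 2bcv)\<^sup>m\<close> are sums of Beta values, which the
  Chu--Vandermonde identity turns into the coefficients of the Cauchy product of the series of
  \<open>J\<^sub>\<nu>(bt)\<close> and \<open>J\<^sub>\<nu>(ct)\<close>.
\<close>

section \<open>Chu--Vandermonde and the finite sum of Beta values\<close>

text \<open>The quotient \<open>pochhammer (x + of_nat j) (n - j) / fact (n - j)\<close> is the
  generalized binomial coefficient of \<open>x + n - 1\<close> over \<open>n - j\<close>. Its upper
  argument does not depend on \<open>j\<close>, so Chu--Vandermonde applies.\<close>

lemma sum_choose_pochhammer: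
  fixes x :: "'a :: field_char_0"
  shows "(\<Sum>j\<le>n. of_nat (k choose j) * (pochhammer (x + of_nat j) (n - j) / fact (n - j))) =
    pochhammer (x + of_nat k) n / fact n"
proof -
  let ?y = "x + of_nat n - 1"
  have "(\<Sum>j\<le>n. of_nat (k choose j) * (pochhammer (x + of_nat j) (n - j) / fact (n - j))) =
    (\<Sum>j\<in>{0..n}. (of_nat k gchoose j) * (?y gchoose (n - j)))"
  proof (rule sum.cong)
    fix j assume "j \<in> {0..n}"
    hence "j \<le> n" by simp
    thus "of_nat (k choose j) * (pochhammer (x + of_nat j) (n - j) / fact (n - j)) =
      (of_nat k gchoose j) * (?y gchoose (n - j))"
      by (simp add: gbinomial_pochhammer' binomial_gbinomial of_nat_diff)
  qed auto
  also have "\<dots> = pochhammer (x + of_nat k) n / fact n"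
    unfolding gbinomial_Vandermonde by (simp add: gbinomial_pochhammer' algebra_simps)
  finally show ?thesis .
qed

lemma rGamma_shift: "rGamma (x + of_nat j) = pochhammer (x + of_nat j) n * rGamma (x + of_nat (j + n))"
  for x :: real
  using pochhammer_rGamma[of "x + of_nat j" n] by (simp add: add.assoc)

text \<open>This evaluates the coefficient of \<open>b ^ (2 * k) * c ^ (2 * (m - k))\<close> in the
  \<open>m\<close>-th moment. Writing every \<open>rGamma (x + j)\<close> as a rising factorial
  times the common \<open>rGamma (x + n)\<close>, where \<open>n = m - k\<close>, leaves the
  Vandermonde sum.\<close>

lemma sum_rGamma_Vandermonde:
  fixes x :: real
  assumes x: "x > 0" and km: "k \<le> m"
  shows "(\<Sum>j\<in>{j. j \<le> k \<and> j \<le> m - k}. rGamma (x + j) / (fact j * fact (k - j) * fact (m - k - j))) =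
    Gamma (x + m) * (rGamma (x + k) / fact k) * (rGamma (x + of_nat (m - k)) / fact (m - k))"
proof -
  define n where "n = m - k"
  have m: "m = k + n" using km by (simp add: n_def)
  have g: "rGamma (x + real j) > 0" for j
    using x Gamma_real_pos[of "x + real j"] by (simp add: rGamma_inverse_Gamma)
  have "(\<Sum>j\<in>{j. j \<le> k \<and> j \<le> n}. rGamma (x + j) / (fact j * fact (k - j) * fact (n - j))) =
    (\<Sum>j\<in>{j. j \<le> k \<and> j \<le> n}. rGamma (x + n) / fact k *
       (of_nat (k choose j) * (pochhammer (x + of_nat j) (n - j) / fact (n - j))))"
  proof (rule sum.cong)
    fix j assume "j \<in> {j. j \<le> k \<and> j \<le> n}"
    hence j: "j \<le> k" "j \<le> n" by auto
    have "rGamma (x + j) = pochhammer (x + j) (n - j) * rGamma (x + n)"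
      using rGamma_shift[of x j "n - j"] j by simp
    thus "rGamma (x + j) / (fact j * fact (k - j) * fact (n - j)) = rGamma (x + n) / fact k *
       (of_nat (k choose j) * (pochhammer (x + of_nat j) (n - j) / fact (n - j)))"
      using j by (simp add: binomial_fact field_simps)
  qed auto
  \<comment> \<open>The terms added here have \<open>k < j\<close>, where \<open>k choose j\<close>
    is 0.\<close>
  also have "\<dots> = (\<Sum>j\<le>n. rGamma (x + n) / fact k *
       (of_nat (k choose j) * (pochhammer (x + of_nat j) (n - j) / fact (n - j))))"
    by (rule sum.mono_neutral_left) (auto simp: not_le)
  also have "\<dots> = rGamma (x + n) / fact k * (pochhammer (x + k) n / fact n)"
    by (simp only: sum_distrib_left [symmetric] sum_choose_pochhammer)
  also have "pochhammer (x + k) n = rGamma (x + k) * Gamma (x + m)"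
    using rGamma_shift[of x k n] g[of m] by (simp add: m Gamma_def field_simps)
  finally show ?thesis by (simp add: n_def mult_ac)
qed

text \<open>Rests on \<open>Gamma (j + 1/2) = sqrt pi * (2j)! / (4^j * j!)\<close>. This form is
  chosen for its cancellations: \<open>fact (2 * j)\<close> meets the denominator of
  \<open>m choose (2 * j)\<close>, and \<open>4 ^ j\<close> meets
  \<open>(2 * b * c) ^ (2 * j)\<close>.\<close>

lemma Beta_half_plus_nat:
  fixes y :: real
  assumes "y > 0"
  shows "Beta (of_nat j + 1 / 2) y =
    sqrt pi * Gamma y * (fact (2 * j) / (4 ^ j * fact j)) * rGamma (y + 1 / 2 + of_nat j)"
proof -
  have "pochhammer (1 / 2) j = Gamma (1 / 2 + of_nat j) / Gamma (1 / 2 :: real)"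
    by (rule pochhammer_Gamma) (use nonpos_Ints_nonpos[of "1 / 2 :: real"] in auto)
  hence "Gamma (of_nat j + 1 / 2 :: real) = pochhammer (1 / 2) j * sqrt pi"
    using Gamma_one_half_real by (simp add: add.commute)
  also have "pochhammer (1 / 2) j = (fact (2 * j) / (4 ^ j * fact j) :: real)"
    using fact_double[of j, where 'a = real] power_mult[of "2 :: real" 2 j] by simp
  finally show ?thesis by (simp add: Beta_altdef add_ac)
qed

text \<open>Only even indices \<open>l = 2 * j\<close> contribute. Expanding
  \<open>(b\<^sup>2 + c\<^sup>2) ^ (m - 2 * j)\<close> with index \<open>i\<close> and collecting
  the terms with \<open>i + j = k\<close> gives, for each \<open>k\<close>, an inner sum over
  \<open>j\<close> that \<open>sum_rGamma_Vandermonde\<close> evaluates.\<close>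

lemma binomial_Beta_sum:
  fixes b c y :: real
  assumes y: "y > 0"
  shows "(\<Sum>l\<le>m. of_nat (m choose l) * (2 * b * c) ^ l * (b\<^sup>2 + c\<^sup>2) ^ (m - l) *
      (if even l then Beta ((of_nat l + 1) / 2) y else 0)) =
    sqrt pi * Gamma y * fact m * Gamma (y + 1 / 2 + m) *
      (\<Sum>k\<le>m. (rGamma (y + 1 / 2 + k) / fact k * b ^ (2 * k)) *
         (rGamma (y + 1 / 2 + of_nat (m - k)) / fact (m - k) * c ^ (2 * (m - k))))"
  (is "?L = ?R")
proof -
  define x where "x = y + 1 / 2"
  define K where "K = sqrt pi * Gamma y * fact m"
  define T where "T = (\<lambda>j i. rGamma (x + real j) / (fact j * fact i * fact (m - 2 * j - i)) *
     (b\<^sup>2) ^ (i + j) * (c\<^sup>2) ^ (m - j - i))"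
  have "?L = (\<Sum>l\<in>(\<lambda>j. 2 * j) ` {j. 2 * j \<le> m}. of_nat (m choose l) * (2 * b * c) ^ l *
      (b\<^sup>2 + c\<^sup>2) ^ (m - l) * Beta ((of_nat l + 1) / 2) y)"
    by (rule sum.mono_neutral_cong_right) (auto elim!: evenE)
  also have "\<dots> = (\<Sum>j\<in>{j. 2 * j \<le> m}. of_nat (m choose (2 * j)) * (2 * b * c) ^ (2 * j) *
      (b\<^sup>2 + c\<^sup>2) ^ (m - 2 * j) * Beta (of_nat j + 1 / 2) y)"
    by (subst sum.reindex) (auto simp: inj_on_def add_divide_distrib)
  also have "\<dots> = (\<Sum>j\<in>{j. 2 * j \<le> m}. K * (\<Sum>i\<le>m - 2 * j. T j i))"
  proof (rule sum.cong)
    fix j assume "j \<in> {j. 2 * j \<le> m}"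
    hence j: "2 * j \<le> m" by simp
    have "(2 * b * c) ^ (2 * j) = 4 ^ j * (b\<^sup>2) ^ j * (c\<^sup>2) ^ j"
      by (simp add: power_mult power_mult_distrib)
    hence "of_nat (m choose (2 * j)) * (2 * b * c) ^ (2 * j) *
        (b\<^sup>2 + c\<^sup>2) ^ (m - 2 * j) * Beta (of_nat j + 1 / 2) y =
      K * (rGamma (x + j) / (fact j * fact (m - 2 * j)) * (b\<^sup>2) ^ j * (c\<^sup>2) ^ j * (b\<^sup>2 + c\<^sup>2) ^ (m - 2 * j))"
      using j unfolding Beta_half_plus_nat[OF y] K_def x_def
      by (simp add: binomial_fact mult_ac)
    also have "rGamma (x + j) / (fact j * fact (m - 2 * j)) * (b\<^sup>2) ^ j * (c\<^sup>2) ^ j * (b\<^sup>2 + c\<^sup>2) ^ (m - 2 * j) =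
        (\<Sum>i\<le>m - 2 * j. T j i)"
      unfolding binomial_ring sum_distrib_left
    proof (rule sum.cong)
      fix i assume "i \<in> {..m - 2 * j}"
      hence i: "i \<le> m - 2 * j" by simp
      have "(c\<^sup>2) ^ (m - j - i) = (c\<^sup>2) ^ j * (c\<^sup>2) ^ (m - 2 * j - i)"
        using i j by (simp flip: power_add)
      thus "rGamma (x + j) / (fact j * fact (m - 2 * j)) * (b\<^sup>2) ^ j * (c\<^sup>2) ^ j *
        (of_nat ((m - 2 * j) choose i) * (b\<^sup>2) ^ i * (c\<^sup>2) ^ (m - 2 * j - i)) = T j i"
        unfolding T_def binomial_fact[OF i] by (simp add: power_add mult_ac)
    qed auto
    finally show "of_nat (m choose (2 * j)) * (2 * b * c) ^ (2 * j) *
        (b\<^sup>2 + c\<^sup>2) ^ (m - 2 * j) * Beta (of_nat j + 1 / 2) y = K * (\<Sum>i\<le>m - 2 * j. T j i)" .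
  qed auto
  also have "\<dots> = K * (\<Sum>j\<in>{j. 2 * j \<le> m}. \<Sum>i\<le>m - 2 * j. T j i)"
    by (simp add: sum_distrib_left)
  also have "(\<Sum>j\<in>{j. 2 * j \<le> m}. \<Sum>i\<le>m - 2 * j. T j i) =
    (\<Sum>(j, i)\<in>(SIGMA j:{j. 2 * j \<le> m}. {..m - 2 * j}). T j i)"
    by (rule sum.Sigma) (auto intro: finite_subset[of _ "{..m}"])
  \<comment> \<open>With \<open>k = i + j\<close> the power of \<open>b\<^sup>2\<close> becomes
    \<open>k\<close> and that of \<open>c\<^sup>2\<close> becomes \<open>m - k\<close>; the bounds
    \<open>0 \<le> i\<close> and \<open>i \<le> m - 2 * j\<close> turn into \<open>j \<le> k\<close>
    and \<open>j \<le> m - k\<close>.\<close>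
  also have "\<dots> = (\<Sum>(k, j)\<in>(SIGMA k:{..m}. {j. j \<le> k \<and> j \<le> m - k}). T j (k - j))"
    by (rule sum.reindex_bij_witness[where i = "\<lambda>(k, j). (j, k - j)" and j = "\<lambda>(j, i). (i + j, j)"]) auto
  also have "\<dots> = (\<Sum>k\<le>m. \<Sum>j\<in>{j. j \<le> k \<and> j \<le> m - k}. T j (k - j))"
    by (rule sum.Sigma [symmetric]) auto
  also have "\<dots> = (\<Sum>k\<le>m. (b\<^sup>2) ^ k * (c\<^sup>2) ^ (m - k) * (\<Sum>j\<in>{j. j \<le> k \<and> j \<le> m - k}.
      rGamma (x + j) / (fact j * fact (k - j) * fact (m - k - j))))"
    unfolding sum_distrib_left
  proof (intro sum.cong refl)
    fix k j assume "k \<in> {..m}" "j \<in> {j. j \<le> k \<and> j \<le> m - k}"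
    hence "k - j + j = k" "m - j - (k - j) = m - k" "m - 2 * j - (k - j) = m - k - j" by auto
    thus "T j (k - j) = (b\<^sup>2) ^ k * (c\<^sup>2) ^ (m - k) * (rGamma (x + j) / (fact j * fact (k - j) * fact (m - k - j)))"
      unfolding T_def by simp
  qed
  also have "\<dots> = (\<Sum>k\<le>m. Gamma (x + m) * ((rGamma (x + k) / fact k * b ^ (2 * k)) *
      (rGamma (x + of_nat (m - k)) / fact (m - k) * c ^ (2 * (m - k)))))"
  proof (rule sum.cong)
    fix k assume "k \<in> {..m}"
    moreover have "x > 0" using y by (simp add: x_def)
    ultimately show "(b\<^sup>2) ^ k * (c\<^sup>2) ^ (m - k) * (\<Sum>j\<in>{j. j \<le> k \<and> j \<le> m - k}.
        rGamma (x + j) / (fact j * fact (k - j) * fact (m - k - j))) =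
      Gamma (x + m) * ((rGamma (x + k) / fact k * b ^ (2 * k)) *
        (rGamma (x + of_nat (m - k)) / fact (m - k) * c ^ (2 * (m - k))))"
      by (subst sum_rGamma_Vandermonde) (simp_all add: power_mult)
  qed auto
  also have "K * \<dots> = ?R"
    by (simp only: sum_distrib_left [symmetric] K_def x_def mult.assoc)
  finally show ?thesis .
qed

section \<open>Beta integrals and moments of the weight\<close>

lemma has_bochner_integral_Beta:
  fixes a b :: real
  assumes "a > 0" "b > 0"
  shows "has_bochner_integral lborel
    (\<lambda>s. s powr (a - 1) * (1 - s) powr (b - 1) * indicator {0..1} s) (Beta a b)"
proof (rule has_bochner_integral_nn_integral)
  show "0 \<le> Beta a b" using assms by (simp add: Beta_def)
  show "(\<integral>\<^sup>+ s. ennreal (s powr (a - 1) * (1 - s) powr (b - 1) * indicator {0..1} s) \<partial>lborel) =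
      ennreal (Beta a b)"
    using nn_integral_has_integral_lebesgue[OF _ has_integral_Beta_real[OF assms]]
    by (simp add: mult_ac)
qed auto

text \<open>Substitution along a nondecreasing \<open>g\<close> for a merely integrable
  \<open>f\<close>; this admits \<open>(1 - v\<^sup>2) powr (y - 1)\<close>, which is unbounded near
  the endpoints if \<open>y < 1\<close>.\<close>

lemma has_bochner_integral_substitution:
  fixes f g g' :: "real \<Rightarrow> real"
  assumes "has_bochner_integral lborel (\<lambda>x. f x * indicator {g a..g b} x) I"
    and "\<And>x. x \<in> {a..b} \<Longrightarrow> (g has_real_derivative g' x) (at x)"
    and "continuous_on {a..b} g'" and "\<And>x. x \<in> {a..b} \<Longrightarrow> g' x \<ge> 0" and "a \<le> b"
  shows "has_bochner_integral lborel (\<lambda>x. f (g x) * g' x * indicator {a..b} x) I"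
proof -
  have 1: "set_integrable lborel {g a..g b} f"
    using assms(1) by (simp add: set_integrable_def has_bochner_integral_iff mult.commute)
  show ?thesis
    using integral_substitution[OF 1 assms(2-5)] assms(1)
    by (simp add: set_integrable_def has_bochner_integral_iff mult_ac)
qed

text \<open>The substitution \<open>s = v\<^sup>2\<close> turns the Beta integral with parameters
  \<open>(l + 1) / 2\<close> and \<open>y\<close> into twice this one.\<close>

lemma has_bochner_integral_half_moment:
  fixes y :: real
  assumes y: "y > 0"
  shows "has_bochner_integral lborel
    (\<lambda>v. v ^ l * (1 - v\<^sup>2) powr (y - 1) * indicator {0..1} v) (Beta ((of_nat l + 1) / 2) y / 2)"
proof -
  let ?a = "(of_nat l + 1) / 2 :: real"
  have "has_bochner_integral lborel
    (\<lambda>v. (v\<^sup>2) powr (?a - 1) * (1 - v\<^sup>2) powr (y - 1) * (2 * v) * indicator {0..1} v) (Beta ?a y)"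
    by (rule has_bochner_integral_substitution[where g = "\<lambda>v. v\<^sup>2"])
       (use has_bochner_integral_Beta[of ?a y] y in \<open>auto intro!: derivative_eq_intros continuous_intros\<close>)
  hence "has_bochner_integral lborel (\<lambda>v. (v\<^sup>2) powr (?a - 1) * (1 - v\<^sup>2) powr (y - 1) * (2 * v) *
      indicator {0..1} v / 2) (Beta ?a y / 2)"
    by (rule has_bochner_integral_divide_zero)
  \<comment> \<open>Equality holds only almost everywhere: for \<open>l = 0\<close> and
    \<open>v = 0\<close> the left side is 0 because of the factor \<open>2 * v\<close>, while the
    right side is 1.\<close>
  moreover have "AE v in lborel. (v\<^sup>2) powr (?a - 1) * (1 - v\<^sup>2) powr (y - 1) * (2 * v) *
      indicator {0..1} v / 2 = v ^ l * (1 - v\<^sup>2) powr (y - 1) * indicator {0..1} v"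
    using AE_lborel_singleton[of "0 :: real"]
  proof eventually_elim
    fix v :: real assume "v \<noteq> 0"
    have "(v\<^sup>2) powr (?a - 1) * v = v ^ l" if "v > 0"
    proof -
      have "(v\<^sup>2) powr (?a - 1) * v = v powr (2 * (?a - 1)) * v powr 1"
        using that by (simp add: powr_powr flip: powr_numeral)
      also have "\<dots> = v powr l" by (simp only: powr_add [symmetric]) (simp add: field_simps)
      also have "\<dots> = v ^ l" using that by (simp add: powr_realpow)
      finally show ?thesis .
    qed
    thus "(v\<^sup>2) powr (?a - 1) * (1 - v\<^sup>2) powr (y - 1) * (2 * v) *
      indicator {0..1} v / 2 = v ^ l * (1 - v\<^sup>2) powr (y - 1) * indicator {0..1} v"
      using \<open>v \<noteq> 0\<close> by (auto simp: indicator_def mult_ac)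
  qed
  ultimately show ?thesis
    by (subst has_bochner_integral_cong_AE[symmetric]) auto
qed

text \<open>The weight is even in \<open>v\<close>, so the two halves of the interval add up for
  even \<open>l\<close> and cancel for odd \<open>l\<close>.\<close>

lemma has_bochner_integral_moment:
  fixes y :: real
  assumes y: "y > 0"
  shows "has_bochner_integral lborel
    (\<lambda>v. v ^ l * (1 - v\<^sup>2) powr (y - 1) * indicator {-1..1} v)
    (if even l then Beta ((of_nat l + 1) / 2) y else 0)"
proof -
  let ?f = "\<lambda>v :: real. v ^ l * (1 - v\<^sup>2) powr (y - 1) * indicator {-1..1} v"
  let ?I = "Beta ((of_nat l + 1) / 2) y / 2"
  have "(\<lambda>v. indicator {0..} v *\<^sub>R ?f v) =
      (\<lambda>v. v ^ l * (1 - v\<^sup>2) powr (y - 1) * indicator {0..1} v)"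
    by (auto simp: indicator_def fun_eq_iff)
  hence *: "has_bochner_integral lborel (\<lambda>v. indicator {0..} v *\<^sub>R ?f v) ?I"
    using has_bochner_integral_half_moment[OF y, of l] by (simp only:)
  have ind: "indicator {-1..1} (- v) = (indicator {-1..1} v :: real)" for v :: real
    by (auto simp: indicator_def)
  show ?thesis
  proof (cases "even l")
    case True
    thus ?thesis using has_bochner_integral_even_function[OF *] ind by simp
  next
    case False
    thus ?thesis using has_bochner_integral_odd_function[OF *] ind by simp
  qed
qed

lemma has_bochner_integral_binomial_moment:
  fixes b c y :: real
  assumes y: "y > 0"
  shows "has_bochner_integral lborel
    (\<lambda>v. (b\<^sup>2 + c\<^sup>2 + 2 * b * c * v) ^ m * (1 - v\<^sup>2) powr (y - 1) * indicator {-1..1} v)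
    (sqrt pi * Gamma y * fact m * Gamma (y + 1 / 2 + m) *
      (\<Sum>k\<le>m. (rGamma (y + 1 / 2 + k) / fact k * b ^ (2 * k)) *
         (rGamma (y + 1 / 2 + of_nat (m - k)) / fact (m - k) * c ^ (2 * (m - k)))))"
proof -
  let ?k = "\<lambda>l. of_nat (m choose l) * (2 * b * c) ^ l * (b\<^sup>2 + c\<^sup>2) ^ (m - l)"
  have "has_bochner_integral lborel (\<lambda>v. \<Sum>l\<le>m. ?k l *
      (v ^ l * (1 - v\<^sup>2) powr (y - 1) * indicator {-1..1} v))
    (\<Sum>l\<le>m. ?k l * (if even l then Beta ((of_nat l + 1) / 2) y else 0))"
    by (intro has_bochner_integral_sum has_bochner_integral_mult_right
        has_bochner_integral_moment y)
  also have "(\<lambda>v. \<Sum>l\<le>m. ?k l * (v ^ l * (1 - v\<^sup>2) powr (y - 1) * indicator {-1..1} v)) =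
    (\<lambda>v. (b\<^sup>2 + c\<^sup>2 + 2 * b * c * v) ^ m * (1 - v\<^sup>2) powr (y - 1) * indicator {-1..1} v)"
  proof
    fix v :: real
    have "(b\<^sup>2 + c\<^sup>2 + 2 * b * c * v) ^ m = (2 * b * c * v + (b\<^sup>2 + c\<^sup>2)) ^ m"
      by (simp add: add_ac)
    also have "\<dots> = (\<Sum>l\<le>m. ?k l * v ^ l)"
      by (subst binomial_ring) (simp add: power_mult_distrib mult_ac)
    finally show "(\<Sum>l\<le>m. ?k l * (v ^ l * (1 - v\<^sup>2) powr (y - 1) * indicator {-1..1} v)) =
      (b\<^sup>2 + c\<^sup>2 + 2 * b * c * v) ^ m * (1 - v\<^sup>2) powr (y - 1) * indicator {-1..1} v"
      by (simp only: sum_distrib_right mult.assoc)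
  qed
  finally show ?thesis by (simp only: binomial_Beta_sum [OF y])
qed

text \<open>By the law of cosines,
  \<open>v = (a\<^sup>2 - b\<^sup>2 - c\<^sup>2) / (2 * b * c)\<close> is minus the cosine of the
  angle opposite \<open>a\<close>. It increases from -1 to 1 as \<open>a\<close> runs over the
  lengths that form a triangle with \<open>b\<close> and \<open>c\<close>, and its derivative is
  \<open>a / (b * c)\<close>.\<close>

lemma has_bochner_integral_side_moment:
  fixes b c y :: real
  assumes y: "y > 0" and b: "b > 0" and c: "c > 0"
  shows "has_bochner_integral lborel
    (\<lambda>a. (1 - ((a\<^sup>2 - b\<^sup>2 - c\<^sup>2) / (2 * b * c))\<^sup>2) powr (y - 1) * (a / (b * c)) *
       indicator {\<bar>b - c\<bar>..b + c} a * (a\<^sup>2) ^ m)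
    (sqrt pi * Gamma y * fact m * Gamma (y + 1 / 2 + m) *
      (\<Sum>k\<le>m. (rGamma (y + 1 / 2 + k) / fact k * b ^ (2 * k)) *
         (rGamma (y + 1 / 2 + of_nat (m - k)) / fact (m - k) * c ^ (2 * (m - k)))))"
  (is "has_bochner_integral _ _ ?I")
proof -
  define g where "g = (\<lambda>a. (a\<^sup>2 - b\<^sup>2 - c\<^sup>2) / (2 * b * c))"
  have inv: "b\<^sup>2 + c\<^sup>2 + 2 * b * c * g a = a\<^sup>2" for a
    using b c by (simp add: g_def)
  have g: "g \<bar>b - c\<bar> = -1" "g (b + c) = 1"
    using b c by (simp_all add: g_def power2_eq_square field_simps)
  have "has_bochner_integral lborel
    (\<lambda>a. ((b\<^sup>2 + c\<^sup>2 + 2 * b * c * g a) ^ m * (1 - (g a)\<^sup>2) powr (y - 1)) * (a / (b * c)) *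
       indicator {\<bar>b - c\<bar>..b + c} a) ?I"
  proof (rule has_bochner_integral_substitution[where g = g and g' = "\<lambda>a. a / (b * c)"
      and f = "\<lambda>v. (b\<^sup>2 + c\<^sup>2 + 2 * b * c * v) ^ m * (1 - v\<^sup>2) powr (y - 1)"])
    show "has_bochner_integral lborel
      (\<lambda>v. (b\<^sup>2 + c\<^sup>2 + 2 * b * c * v) ^ m * (1 - v\<^sup>2) powr (y - 1) * indicator {g \<bar>b - c\<bar>..g (b + c)} v) ?I"
      unfolding g by (rule has_bochner_integral_binomial_moment[OF y])
    show "(g has_real_derivative a / (b * c)) (at a)" for a
      unfolding g_def using b c by (auto intro!: derivative_eq_intros)
    show "continuous_on {\<bar>b - c\<bar>..b + c} (\<lambda>a. a / (b * c))"
      using b c by (intro continuous_intros) auto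
  qed (use b c in auto)
  thus ?thesis unfolding inv by (simp add: g_def mult_ac)
qed

text \<open>Heron's radicand factors as \<open>(b * c / 2)\<^sup>2 * (1 - v\<^sup>2)\<close>, with
  \<open>v\<close> the substitution variable of the moments; the indicator encodes the triangle
  inequalities.\<close>

lemma heron_area_powr:
  fixes a b c :: real
  assumes a: "a > 0" and b: "b > 0" and c: "c > 0"
  shows "heron_area a b c powr (2 * q) = (b * c / 2) powr (2 * q) *
    ((1 - ((a\<^sup>2 - b\<^sup>2 - c\<^sup>2) / (2 * b * c))\<^sup>2) powr q * indicator {\<bar>b - c\<bar>..b + c} a)"
proof (cases "a \<in> {\<bar>b - c\<bar>..b + c}")
  case True
  define D where "D = 1 - ((a\<^sup>2 - b\<^sup>2 - c\<^sup>2) / (2 * b * c))\<^sup>2"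
  define s where "s = (a + b + c) / 2"
  have eq: "s * (s - a) * (s - b) * (s - c) = (b * c / 2)\<^sup>2 * D"
    using b c by (simp add: s_def D_def field_simps power2_eq_square)
  have "s * (s - a) * (s - b) * (s - c) \<ge> 0"
    using True a b c by (intro mult_nonneg_nonneg) (auto simp: s_def)
  hence D: "D \<ge> 0" unfolding eq using b c by (simp add: zero_le_mult_iff)
  have "heron_area a b c = b * c / 2 * sqrt D"
    using True b c unfolding heron_area_def Let_def s_def[symmetric] eq
    by (auto simp: real_sqrt_mult)
  moreover have "sqrt D powr (2 * q) = D powr q"
    unfolding powr_half_sqrt[OF D, symmetric] by (simp only: powr_powr) simp
  ultimately show ?thesis
    using True b c D by (simp only: D_def[symmetric] powr_mult) simp
next
  case False
  \<comment> \<open>A triangle inequality fails here. As \<open>0 powr x\<close> is 0 for every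
    \<open>x\<close>, both sides vanish even for negative \<open>q\<close>.\<close>
  hence "heron_area a b c = 0" by (auto simp: heron_area_def)
  thus ?thesis using False by simp
qed

section \<open>Termwise integration of a power series\<close>

text \<open>On the support of \<open>w\<close> the \<open>m\<close>-th term is dominated by
  \<open>norm (w x) * (norm (u m) * R ^ m)\<close>. Since \<open>w\<close> is integrable, being the
  case \<open>m = 0\<close> of the moments, the integrals of the norms are summable and sum and
  integral may be exchanged.\<close>

lemma has_bochner_integral_power_series:
  fixes w g :: "'a \<Rightarrow> real" and u :: "nat \<Rightarrow> 'b :: {banach, real_normed_field, second_countable_topology}"
  assumes int: "\<And>m. has_bochner_integral M (\<lambda>x. w x * g x ^ m) (I m)"
    and bound: "\<And>x. w x \<noteq> 0 \<Longrightarrow> \<bar>g x\<bar> \<le> R"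
    and u: "summable (\<lambda>m. norm (u m) * R ^ m)"
  shows "has_bochner_integral M (\<lambda>x. of_real (w x) * (\<Sum>m. u m * of_real (g x) ^ m))
    (\<Sum>m. u m * of_real (I m))"
proof -
  have w: "integrable M w" using int[of 0] by (simp add: has_bochner_integral_iff)
  let ?f = "\<lambda>m x. u m * of_real (w x * g x ^ m)"
  have int': "has_bochner_integral M (?f m) (u m * of_real (I m))" for m
    using int[of m] by (intro has_bochner_integral_mult_right has_bochner_integral_bounded_linear[OF bounded_linear_of_real])
  have sumg: "summable (\<lambda>m. norm (u m * of_real (g x) ^ m))" if "w x \<noteq> 0" for x
    by (rule summable_comparison_test'[OF u])
       (auto simp: norm_mult norm_power intro!: mult_left_mono power_mono bound that)
  have le: "norm (?f m x) \<le> norm (w x) * (norm (u m) * R ^ m)" for m x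
  proof (cases "w x = 0")
    case False
    hence "\<bar>g x\<bar> ^ m \<le> R ^ m" by (intro power_mono bound) auto
    hence "\<bar>w x\<bar> * norm (u m) * \<bar>g x\<bar> ^ m \<le> \<bar>w x\<bar> * norm (u m) * R ^ m"
      by (rule mult_left_mono) auto
    thus ?thesis by (simp add: norm_mult norm_power abs_mult power_abs mult_ac)
  qed simp
  have abs: "summable (\<lambda>m. norm (?f m x))" for x
  proof (rule summable_comparison_test'[OF summable_mult[OF u]])
    fix m show "norm (norm (?f m x)) \<le> norm (w x) * (norm (u m) * R ^ m)"
      using le[of m x] by simp
  qed
  have norms: "summable (\<lambda>m. \<integral>x. norm (?f m x) \<partial>M)"
  proof (rule summable_comparison_test'[OF summable_mult[OF u]])
    fix m
    have "(\<integral>x. norm (?f m x) \<partial>M) \<le> (\<integral>x. norm (w x) * (norm (u m) * R ^ m) \<partial>M)"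
      using int'[of m] w le[of m] by (intro integral_mono) (auto simp: has_bochner_integral_iff)
    thus "norm (\<integral>x. norm (?f m x) \<partial>M) \<le> (\<integral>x. norm (w x) \<partial>M) * (norm (u m) * R ^ m)"
      by simp
  qed
  have fint: "integrable M (?f m)" for m using int'[of m] by (simp add: has_bochner_integral_iff)
  have "has_bochner_integral M (\<lambda>x. \<Sum>m. ?f m x) (\<Sum>m. u m * of_real (I m))"
    using integrable_suminf[OF fint AE_I2[OF abs] norms]
      integral_suminf[OF fint AE_I2[OF abs] norms]
    unfolding has_bochner_integral_integral_eq[OF int'] by (simp add: has_bochner_integral_iff)
  also have "(\<lambda>x. \<Sum>m. ?f m x) = (\<lambda>x. of_real (w x) * (\<Sum>m. u m * of_real (g x) ^ m))"
  proof
    fix x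
    show "(\<Sum>m. ?f m x) = of_real (w x) * (\<Sum>m. u m * of_real (g x) ^ m)"
    proof (cases "w x = 0")
      case False
      from suminf_mult[OF summable_norm_cancel[OF sumg[OF False]], of "of_real (w x)"]
      show ?thesis by (simp add: mult_ac)
    qed simp
  qed
  finally show ?thesis .
qed

section \<open>The Bessel series and principal powers\<close>

lemma summable_bessel_coeff:
  fixes x :: real and z :: complex
  assumes "x > 0"
  shows "summable (\<lambda>m. norm ((- 1) ^ m * of_real (rGamma (x + of_nat m)) / fact m * z ^ m))"
proof -
  let ?f = "\<lambda>m. norm ((- 1) ^ m * of_real (rGamma (x + of_nat m)) / fact m * z ^ m)"
  define G where "G = (\<lambda>m :: nat. \<bar>rGamma (x + of_nat m)\<bar>)"
  have f: "?f m = G m / fact m * norm z ^ m" for m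
    by (simp add: G_def norm_mult norm_divide norm_power)
  \<comment> \<open>Consecutive terms have ratio \<open>norm z / ((x + m) * (m + 1))\<close>. For
    \<open>m \<ge> N\<close> the denominator is at least \<open>x * N \<ge> 2 * norm z\<close>, so
    the ratio is at most 1/2.\<close>
  obtain N :: nat where N: "real N \<ge> 2 * norm z / x" using real_arch_simple by blast
  show ?thesis
  proof (rule summable_ratio_test[where c = "1 / 2" and N = N])
    fix m assume m: "m \<ge> N"
    let ?d = "(x + of_nat m) * (of_nat m + 1)"
    have d: "?d > 0" using assms by simp
    have "2 * norm z \<le> x * N" using N assms by (simp add: field_simps)
    also have "x * N \<le> ?d" using assms m by (intro mult_mono) auto
    finally have le: "norm z / ?d \<le> 1 / 2" using d by (simp add: field_simps)
    have "G (Suc m) = G m / (x + of_nat m)"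
      using rGamma_plus1[of "x + of_nat m", symmetric] assms
      by (simp add: G_def abs_mult add_ac)
    hence "?f (Suc m) = norm z / ?d * ?f m"
      unfolding f by (simp add: add_ac mult_ac)
    also have "\<dots> \<le> 1 / 2 * ?f m" by (rule mult_right_mono[OF le]) auto
    finally show "norm (?f (Suc m)) \<le> 1 / 2 * norm (?f m)" by simp
  qed simp
qed

lemma bessel_J_real_order:
  "bessel_J (of_real \<nu>) z = (z / 2) powr of_real \<nu> *
    (\<Sum>m. (- 1) ^ m * of_real (rGamma (\<nu> + 1 + of_nat m)) / fact m * (z\<^sup>2 / 4) ^ m)"
proof -
  have "rGamma (complex_of_real \<nu> + of_nat m + 1) = of_real (rGamma (\<nu> + 1 + of_nat m))" for m
    by (simp add: rGamma_complex_of_real [symmetric] add_ac)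
  moreover have "(z / 2) ^ (2 * m) = (z\<^sup>2 / 4) ^ m" for m
    by (simp add: power_mult power_divide)
  ultimately show ?thesis unfolding bessel_J_def by simp
qed

text \<open>A positive real factor leaves the argument of \<open>t\<close> unchanged, so the
  principal power splits. This isolates a power series in \<open>a\<^sup>2\<close>, ready for
  termwise integration.\<close>

lemma bessel_J_of_real_mult:
  assumes a: "a > 0" and t: "t \<noteq> 0"
  shows "bessel_J (of_real \<nu>) (of_real a * t) = of_real ((a / 2) powr \<nu>) * t powr of_real \<nu> *
    (\<Sum>m. (- 1) ^ m * of_real (rGamma (\<nu> + 1 + of_nat m)) / fact m * (t\<^sup>2 / 4) ^ m * of_real (a\<^sup>2) ^ m)"
proof -
  have "(of_real a * t / 2) powr of_real \<nu> = of_real ((a / 2) powr \<nu>) * t powr of_real \<nu>"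
    using powr_times_real_left[of "of_real (a / 2)" t "of_real \<nu>"] powr_of_real[of "a / 2" \<nu>] a
    by simp
  moreover have "((of_real a * t)\<^sup>2 / 4) ^ m = (t\<^sup>2 / 4) ^ m * of_real (a\<^sup>2) ^ m" for m
    by (simp add: power_mult_distrib power_divide)
  ultimately show ?thesis unfolding bessel_J_real_order by (simp add: mult_ac)
qed

text \<open>Off the cut the principal logarithm satisfies \<open>Ln (inverse t) = - Ln t\<close>, so
  the two powers of \<open>t\<close> cancel without a branch correction.\<close>

lemma powr_divide_mult_powr:
  fixes t :: complex
  assumes "t \<notin> \<real>\<^sub>\<le>\<^sub>0" and "r > 0"
  shows "(of_real r / t) powr of_real \<nu> * t powr of_real \<nu> = of_real (r powr \<nu>)"
proof -
  have t: "t \<noteq> 0" using assms by auto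
  have "(of_real r / t) powr of_real \<nu> = of_real r powr of_real \<nu> * inverse t powr of_real \<nu>"
    unfolding divide_inverse by (rule powr_times_real_left) (use assms in auto)
  moreover have "inverse t powr of_real \<nu> * t powr of_real \<nu> = 1"
    using assms t by (simp add: powr_def Ln_inverse flip: exp_add)
  ultimately show ?thesis using powr_of_real[of r \<nu>] assms by (simp add: mult.assoc)
qed

section \<open>Assembly of the integral formula\<close>

theorem theorem2:
  fixes b c \<nu> :: real and t :: complex
  assumes "b > 0" and "c > 0" and "\<nu> > - 1 / 2"
    and "t \<notin> \<real>\<^sub>\<le>\<^sub>0"
  defines "f \<equiv> (\<lambda>a :: real.
      complex_of_real (heron_area a b c powr (2 * \<nu> - 1) * a powr (1 - \<nu>)) *
      bessel_J (of_real \<nu>) (of_real a * t))"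
  shows "set_integrable lborel {0<..} f \<and>
    (LBINT a:{0<..}. f a) =
      complex_of_real (2 powr (1 - \<nu>) * sqrt pi * Gamma (\<nu> + 1 / 2)) *
      (of_real (b * c) / t) powr (of_real \<nu>) *
      bessel_J (of_real \<nu>) (of_real b * t) * bessel_J (of_real \<nu>) (of_real c * t)"
proof -
  have t: "t \<noteq> 0" using assms by auto
  \<comment> \<open>Thus \<open>2 * (y - 1)\<close> is the exponent \<open>2 * \<nu> - 1\<close> of
    the area, and \<open>y + 1 / 2 = \<nu> + 1\<close> is the Gamma argument at which the Bessel
    series starts.\<close>
  define y where "y = \<nu> + 1 / 2"
  have y: "y > 0" using assms by (simp add: y_def)
  define \<beta> :: "nat \<Rightarrow> complex" where
    "\<beta> = (\<lambda>m. (- 1) ^ m * of_real (rGamma (\<nu> + 1 + of_nat m)) / fact m)"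
  define z where "z = t\<^sup>2 / 4"
  define \<Lambda> where "\<Lambda> = (\<lambda>x. \<Sum>m. \<beta> m * z ^ m * of_real (x\<^sup>2) ^ m)"
  define W where "W = (\<lambda>a. (1 - ((a\<^sup>2 - b\<^sup>2 - c\<^sup>2) / (2 * b * c))\<^sup>2) powr (y - 1) * (a / (b * c)) *
       indicator {\<bar>b - c\<bar>..b + c} a)"
  define I where "I = (\<lambda>m. sqrt pi * Gamma y * fact m * Gamma (y + 1 / 2 + m) *
      (\<Sum>k\<le>m. (rGamma (y + 1 / 2 + k) / fact k * b ^ (2 * k)) *
         (rGamma (y + 1 / 2 + of_nat (m - k)) / fact (m - k) * c ^ (2 * (m - k)))))"
  \<comment> \<open>\<open>K\<close> collects what does not depend on \<open>a\<close>: the constant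
    from Heron's formula, the \<open>b * c\<close> that undoes the denominator of the derivative in
    \<open>W\<close>, and the constant powers in front of the Bessel series.\<close>
  define K where "K = of_real ((b * c / 2) powr (2 * \<nu> - 1) * (b * c) * (1 / 2) powr \<nu>) * t powr of_real \<nu>"
  have J: "bessel_J (of_real \<nu>) (of_real a * t) = of_real ((a / 2) powr \<nu>) * t powr of_real \<nu> * \<Lambda> a"
    if "a > 0" for a
    using bessel_J_of_real_mult[OF that t, of \<nu>] by (simp add: \<Lambda>_def \<beta>_def z_def)
  have summable: "summable (\<lambda>m. norm (\<beta> m * x ^ m))" for x
    unfolding \<beta>_def by (rule summable_bessel_coeff) (use assms in auto)
  have summable': "summable (\<lambda>m. norm (\<beta> m * z ^ m * of_real (x\<^sup>2) ^ m))" for x :: real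
    using summable[of "z * of_real (x\<^sup>2)"] by (simp add: power_mult_distrib mult.assoc)

  have int: "has_bochner_integral lborel (\<lambda>a. of_real (W a) * \<Lambda> a) (\<Sum>m. \<beta> m * z ^ m * of_real (I m))"
    unfolding \<Lambda>_def
  proof (rule has_bochner_integral_power_series[where R = "(b + c)\<^sup>2"])
    show "has_bochner_integral lborel (\<lambda>a. W a * (a\<^sup>2) ^ m) (I m)" for m
      unfolding W_def I_def by (rule has_bochner_integral_side_moment) (use y assms in auto)
    show "\<bar>a\<^sup>2\<bar> \<le> (b + c)\<^sup>2" if "W a \<noteq> 0" for a
    proof -
      have "\<bar>b - c\<bar> \<le> a" "a \<le> b + c" using that by (auto simp: W_def split: split_indicator_asm)
      thus ?thesis using power_mono[of a "b + c" 2] by simp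
    qed
    show "summable (\<lambda>m. norm (\<beta> m * z ^ m) * ((b + c)\<^sup>2) ^ m)"
      using summable'[of "b + c"] by (simp add: norm_mult norm_power flip: of_real_add)
  qed

  \<comment> \<open>The factors \<open>fact m\<close> and \<open>Gamma (\<nu> + 1 + m)\<close> of
    the moment cancel against \<open>\<beta> m\<close>; splitting \<open>(- 1) ^ m\<close> and
    \<open>z ^ m\<close> at \<open>k\<close> leaves a Cauchy product coefficient.\<close>
  have "\<beta> m * z ^ m * of_real (I m) = of_real (sqrt pi * Gamma y) *
      (\<Sum>k\<le>m. (\<beta> k * z ^ k * of_real (b\<^sup>2) ^ k) * (\<beta> (m - k) * z ^ (m - k) * of_real (c\<^sup>2) ^ (m - k)))" for m
  proof -
    have "\<nu> + 1 + m > 0" using assms by simp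
    hence "Gamma (\<nu> + 1 + m) > 0" by (rule Gamma_real_pos)
    hence G: "rGamma (\<nu> + 1 + m) * Gamma (\<nu> + 1 + m) = 1" by (simp add: rGamma_inverse_Gamma)
    have "\<beta> m * of_real (I m) = (- 1) ^ m * of_real (sqrt pi * Gamma y) *
        of_real (rGamma (\<nu> + 1 + m) * Gamma (\<nu> + 1 + m)) *
        of_real (\<Sum>k\<le>m. (rGamma (\<nu> + 1 + k) / fact k * b ^ (2 * k)) *
         (rGamma (\<nu> + 1 + of_nat (m - k)) / fact (m - k) * c ^ (2 * (m - k))))"
      by (simp add: \<beta>_def I_def y_def add_ac)
    also have "\<dots> = of_real (sqrt pi * Gamma y) * ((- 1) ^ m *
        of_real (\<Sum>k\<le>m. (rGamma (\<nu> + 1 + k) / fact k * b ^ (2 * k)) *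
         (rGamma (\<nu> + 1 + of_nat (m - k)) / fact (m - k) * c ^ (2 * (m - k)))))"
      unfolding G by simp
    finally have "\<beta> m * z ^ m * of_real (I m) = of_real (sqrt pi * Gamma y) * ((- 1) ^ m * z ^ m *
        of_real (\<Sum>k\<le>m. (rGamma (\<nu> + 1 + k) / fact k * b ^ (2 * k)) *
         (rGamma (\<nu> + 1 + of_nat (m - k)) / fact (m - k) * c ^ (2 * (m - k)))))"
      by (simp add: mult_ac)
    also have "(- 1) ^ m * z ^ m *
        of_real (\<Sum>k\<le>m. (rGamma (\<nu> + 1 + k) / fact k * b ^ (2 * k)) *
         (rGamma (\<nu> + 1 + of_nat (m - k)) / fact (m - k) * c ^ (2 * (m - k)))) =
      (\<Sum>k\<le>m. (\<beta> k * z ^ k * of_real (b\<^sup>2) ^ k) * (\<beta> (m - k) * z ^ (m - k) * of_real (c\<^sup>2) ^ (m - k)))"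
      unfolding of_real_sum sum_distrib_left
    proof (rule sum.cong)
      fix k assume "k \<in> {..m}"
      hence pw: "u ^ m = u ^ k * u ^ (m - k)" for u :: complex by (simp flip: power_add)
      show "(- 1) ^ m * z ^ m * of_real ((rGamma (\<nu> + 1 + k) / fact k * b ^ (2 * k)) *
         (rGamma (\<nu> + 1 + of_nat (m - k)) / fact (m - k) * c ^ (2 * (m - k)))) =
       (\<beta> k * z ^ k * of_real (b\<^sup>2) ^ k) * (\<beta> (m - k) * z ^ (m - k) * of_real (c\<^sup>2) ^ (m - k))"
        unfolding pw \<beta>_def by (simp add: power_mult)
    qed auto
    finally show ?thesis .
  qed
  moreover have "(\<lambda>m. \<Sum>k\<le>m. (\<beta> k * z ^ k * of_real (b\<^sup>2) ^ k) *
      (\<beta> (m - k) * z ^ (m - k) * of_real (c\<^sup>2) ^ (m - k))) sums (\<Lambda> b * \<Lambda> c)"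
    unfolding \<Lambda>_def by (rule Cauchy_product_sums) (rule summable')+
  ultimately have sums: "(\<lambda>m. \<beta> m * z ^ m * of_real (I m)) sums (of_real (sqrt pi * Gamma y) * (\<Lambda> b * \<Lambda> c))"
    by (simp only: sums_mult)
  from has_bochner_integral_mult_right[OF int, of K]
  have "has_bochner_integral lborel (\<lambda>a. K * (of_real (W a) * \<Lambda> a))
      (K * (of_real (sqrt pi * Gamma y) * (\<Lambda> b * \<Lambda> c)))"
    unfolding sums_unique[OF sums, symmetric] by simp
  \<comment> \<open>The factor \<open>a\<close> in \<open>W\<close> comes from
    \<open>a powr (1 - \<nu>)\<close> and the \<open>a powr \<nu>\<close> of the Bessel
    function.\<close>
  also have "(\<lambda>a. K * (of_real (W a) * \<Lambda> a)) = (\<lambda>a. indicator {0<..} a *\<^sub>R f a)"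
  proof
    fix a :: real
    consider "a > 0" | "a = 0" | "a < 0" by linarith
    thus "K * (of_real (W a) * \<Lambda> a) = indicator {0<..} a *\<^sub>R f a"
    proof cases
      case 1
      have "a powr (1 - \<nu>) * (a / 2) powr \<nu> = a * (1 / 2) powr \<nu>"
        using 1 powr_mult[of a "1 / 2" \<nu>] powr_add[of a "1 - \<nu>" \<nu>] by simp
      moreover have "heron_area a b c powr (2 * \<nu> - 1) = (b * c / 2) powr (2 * \<nu> - 1) *
          (W a * (b * c) / a)"
        using heron_area_powr[OF 1 assms(1,2), of "y - 1"] 1 assms(1,2)
        by (simp add: W_def y_def algebra_simps)
      ultimately have eq: "heron_area a b c powr (2 * \<nu> - 1) * a powr (1 - \<nu>) * (a / 2) powr \<nu> =
          (b * c / 2) powr (2 * \<nu> - 1) * (b * c) * (1 / 2) powr \<nu> * W a"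
        by (simp only: mult.assoc) (use 1 in simp)
      have "indicator {0<..} a *\<^sub>R f a =
          of_real (heron_area a b c powr (2 * \<nu> - 1) * a powr (1 - \<nu>) * (a / 2) powr \<nu>) *
          (t powr of_real \<nu> * \<Lambda> a)"
        unfolding f_def J[OF 1] using 1 by simp
      thus ?thesis unfolding eq K_def by simp
    \<comment> \<open>At \<open>a = 0\<close>, which lies in the interval when \<open>b = c\<close>,
      \<open>W\<close> vanishes through its factor \<open>a\<close>; for \<open>a < 0\<close> its
      indicator vanishes.\<close>
    qed (auto simp: W_def split: split_indicator)
  qed
  finally have main: "has_bochner_integral lborel (\<lambda>a. indicator {0<..} a *\<^sub>R f a)
    (K * (of_real (sqrt pi * Gamma y) * (\<Lambda> b * \<Lambda> c)))" .

  define T where "T = t powr of_real \<nu>"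
  define Q where "Q = (of_real (b * c) / t) powr of_real \<nu>"
  \<comment> \<open>\<open>K\<close> carries a single factor \<open>T\<close>, whereas the two
    Bessel functions need two; trading the real factor \<open>(b * c) powr \<nu>\<close> for
    \<open>Q * T\<close> supplies the second one.\<close>
  have QT: "Q * T = of_real ((b * c) powr \<nu>)"
    unfolding Q_def T_def by (rule powr_divide_mult_powr) (use assms in auto)
  have "(b * c / 2) powr (2 * \<nu> - 1) * (b * c) * (1 / 2) powr \<nu> =
      2 powr (1 - \<nu>) * (b * c) powr \<nu> * (b / 2) powr \<nu> * (c / 2) powr \<nu>"
  proof -
    \<comment> \<open>Writing \<open>b * c\<close> as \<open>2 * (b * c / 2)\<close> raises the
      exponent to \<open>2 * \<nu>\<close>. One half of that power gives
      \<open>(b / 2) powr \<nu> * (c / 2) powr \<nu>\<close> up to a power of 2, the other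
      \<open>(b * c) powr \<nu>\<close>.\<close>
    have "(b * c / 2) powr (2 * \<nu> - 1) * (b * c) = (b * c / 2) powr (2 * \<nu>) * 2"
      using assms(1,2) by (simp add: powr_diff)
    also have "(b * c / 2) powr (2 * \<nu>) = (b * c / 2) powr \<nu> * (b * c / 2) powr \<nu>"
      by (simp flip: powr_add)
    finally show ?thesis
      using assms(1,2) by (simp add: powr_divide powr_mult powr_diff)
  qed
  hence "K * (of_real (sqrt pi * Gamma y) * (\<Lambda> b * \<Lambda> c)) =
    of_real (2 powr (1 - \<nu>) * sqrt pi * Gamma y) * (Q * T) *
      (of_real ((b / 2) powr \<nu>) * \<Lambda> b) * (of_real ((c / 2) powr \<nu>) * T * \<Lambda> c)"
    unfolding K_def QT T_def[symmetric] by (simp only:) (simp add: mult_ac)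
  also have "\<dots> = of_real (2 powr (1 - \<nu>) * sqrt pi * Gamma y) * Q *
      bessel_J (of_real \<nu>) (of_real b * t) * bessel_J (of_real \<nu>) (of_real c * t)"
    unfolding J[OF assms(1)] J[OF assms(2)] T_def by (simp add: mult_ac)
  finally show ?thesis
    using main unfolding set_integrable_def set_lebesgue_integral_def has_bochner_integral_iff
    by (simp add: Q_def y_def)
qed

end
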